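(* Let $p>1$ and $\mu>0$. Let $F$ be a differentiable higher order strongly general convex function (with constant $\mu$) on the general convex set $K_g$. Then $$\langle F'(g(u))-F'(g(v)),\,g(u)-g(v)\rangle\ge 2\mu\,\|g(v)-g(u)\|^p\qquad\text{for all } g(u),g(v)\in K_g .$$
   Context: $H$ is a real Hilbert space with inner product $\langle\cdot,\cdot\rangle$ and norm $\|\cdot\|$, and $g:H\to H$ is an arbitrary function. $K_g\subseteq H$ is a general convex set with respect to $g$: $g(u)+t(g(v)-g(u))\in K_g$ for all $u,v\in H$ with $g(u),g(v)\in K_g$ and all $t\in[0,1]$. As a standing assumption $g$ is onto $K_g$ (every point of $K_g$ is $g(v)$ for some $v\in H$). "For all $g(u),g(v)\in K_g$" means for all $u,v\in H$ with $g(u),g(v)\in K_g$. For $p>1$ and $\mu>0$, a real-valued function $F$ on $K_g$ is higher order strongly general convex with constant $\mu$ if $$F\big(g(u)+t(g(v)-g(u))\big)\le(1-t)F(g(u))+tF(g(v))-\mu\{t^p(1-t)+t(1-t)^p\}\|g(v)-g(u)\|^p$$ for all $g(u),g(v)\in K_g$ and $t\in[0,1]$. "Differentiable" means Fréchet differentiable at the points of $K_g$ ($F$ being understood as defined near $K_g$), with $F'$ identified with an element of $H$. *)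

theory Defs
  imports "HOL-Analysis.Analysis"
begin

definition general_convex_set :: "('a::real_vector \<Rightarrow> 'a) \<Rightarrow> 'a set \<Rightarrow> bool" where
  "general_convex_set g K \<longleftrightarrow>
    (\<forall>u v. g u \<in> K \<longrightarrow> g v \<in> K \<longrightarrow>
      (\<forall>t\<in>{0..1}. g u + t *\<^sub>R (g v - g u) \<in> K))"

text \<open>
  The exponent is real. All bases below are nonnegative, and \<open>0 powr p = 0\<close> is the
  usual value for \<open>p > 0\<close>. Only the values of \<open>F\<close> on \<open>K\<close> matter when
  \<open>general_convex_set g K\<close> holds.
\<close>

definition higher_order_strongly_general_convex ::
    "real \<Rightarrow> real \<Rightarrow> ('a::real_normed_vector \<Rightarrow> 'a) \<Rightarrow> 'a set \<Rightarrow> ('a \<Rightarrow> real) \<Rightarrow> bool" where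
  "higher_order_strongly_general_convex p \<mu> g K F \<longleftrightarrow>
    (\<forall>u v. g u \<in> K \<longrightarrow> g v \<in> K \<longrightarrow>
      (\<forall>t\<in>{0..1}.
        F (g u + t *\<^sub>R (g v - g u))
          \<le> (1 - t) * F (g u) + t * F (g v)
            - \<mu> * (t powr p * (1 - t) + t * (1 - t) powr p) * norm (g v - g u) powr p))"

end

theory Submission
  imports Defs
begin

text \<open>
  Convexity with a modulus says how far the graph of \<open>F\<close> lies below a chord. Dividing
  that estimate by \<open>t\<close> and letting \<open>t\<close> tend to \<open>0\<close> turns it into a statement about
  tangents: \<open>F\<close> exceeds its linearisation at \<open>g u\<close> by at least
  \<open>\<mu> * norm (g v - g u) powr p\<close> at \<open>g v\<close>
  (lemma \<open>strongly_general_convex_above_tangent\<close>). The full constant \<open>\<mu>\<close> survives because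
  the modulus divided by \<open>t\<close> is \<open>t powr (p - 1) * (1 - t) + (1 - t) powr p\<close>, whose first
  summand vanishes in the limit by \<open>p > 1\<close> while the second one tends to \<open>1\<close>.
  The tangent inequality at \<open>g u\<close> and the one at \<open>g v\<close> have opposite differences of
  values of \<open>F\<close>; adding them cancels these and leaves the two gradients, with the
  constant doubled.
\<close>

lemma GDERIV_directional_quotient_tendsto:
  assumes "GDERIV F x :> D"
  shows "((\<lambda>t. (F (x + t *\<^sub>R d) - F x) / t) \<longlongrightarrow> inner D d) (at_right 0)"
proof -
  have "((\<lambda>t. x + t *\<^sub>R d) has_derivative (\<lambda>t. t *\<^sub>R d)) (at 0)"
    by (auto intro!: derivative_eq_intros)
  moreover have "(F has_derivative (\<lambda>h. inner h D)) (at (x + 0 *\<^sub>R d))"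
    using assms by (simp add: gderiv_def)
  ultimately have "((\<lambda>t. F (x + t *\<^sub>R d)) has_derivative (\<lambda>t. inner (t *\<^sub>R d) D)) (at 0)"
    by (rule has_derivative_compose)
  then have "((\<lambda>t. F (x + t *\<^sub>R d)) has_field_derivative inner D d) (at 0)"
    by (simp add: has_field_derivative_def inner_commute mult_commute_abs)
  then have "((\<lambda>t. (F (x + t *\<^sub>R d) - F x) / t) \<longlongrightarrow> inner D d) (at 0)"
    by (simp add: DERIV_def)
  then show ?thesis
    by (rule filterlim_mono) (simp_all add: at_le)
qed

lemma convexity_modulus_quotient_tendsto:
  fixes p :: real
  assumes "p > 1"
  shows "((\<lambda>t. t powr (p - 1) * (1 - t) + (1 - t) powr p) \<longlongrightarrow> 1) (at_right 0)"
proof -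
  have "((\<lambda>t. t powr (p - 1)) \<longlongrightarrow> 0) (at_right (0::real))"
    using assms by (auto intro!: tendsto_eq_intros
      eventually_mono[OF eventually_at_right_less])
  moreover have "((\<lambda>t. 1 - t) \<longlongrightarrow> 1) (at_right (0::real))"
    by (auto intro!: tendsto_eq_intros)
  moreover from this have "((\<lambda>t. (1 - t) powr p) \<longlongrightarrow> 1 powr p) (at_right (0::real))"
    by (intro tendsto_powr tendsto_const) simp_all
  ultimately have "((\<lambda>t. t powr (p - 1) * (1 - t) + (1 - t) powr p) \<longlongrightarrow> 0 * 1 + 1 powr p)
      (at_right 0)"
    by (intro tendsto_add tendsto_mult)
  then show ?thesis
    by simp
qed

text \<open>
  The first-order form of the convexity condition: it compares the difference quotient
  of \<open>F\<close> towards \<open>g v\<close> with the chord slope, and both sides converge as the step shrinks.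
\<close>

lemma strongly_general_convex_above_tangent:
  fixes F :: "'a::real_inner \<Rightarrow> real"
  assumes "p > 1"
    and "higher_order_strongly_general_convex p \<mu> g K F"
    and "g u \<in> K" "g v \<in> K"
    and "GDERIV F (g u) :> D"
  shows "F (g u) + inner D (g v - g u) + \<mu> * norm (g v - g u) powr p \<le> F (g v)"
proof -
  define d where "d = g v - g u"
  define m where "m t = t powr (p - 1) * (1 - t) + (1 - t) powr p" for t :: real
  have quotient_le:
    "(F (g u + t *\<^sub>R d) - F (g u)) / t \<le> F (g v) - F (g u) - \<mu> * m t * norm d powr p"
    if "0 < t" "t < 1" for t
  proof -
    have "t powr p = t * t powr (p - 1)"
      using \<open>0 < t\<close> by (simp add: powr_mult_base)
    then have modulus: "t powr p * (1 - t) + t * (1 - t) powr p = t * m t"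
      by (simp add: m_def algebra_simps)
    have "F (g u + t *\<^sub>R d) \<le> (1 - t) * F (g u) + t * F (g v)
        - \<mu> * (t powr p * (1 - t) + t * (1 - t) powr p) * norm d powr p"
      using assms(2-4) that unfolding higher_order_strongly_general_convex_def d_def by simp
    then have "F (g u + t *\<^sub>R d) - F (g u)
        \<le> (F (g v) - F (g u) - \<mu> * m t * norm d powr p) * t"
      unfolding modulus by (simp add: algebra_simps)
    then show ?thesis
      using \<open>0 < t\<close> by (simp add: pos_divide_le_eq)
  qed
  have "((\<lambda>t. F (g v) - F (g u) - \<mu> * m t * norm d powr p) \<longlongrightarrow>
      F (g v) - F (g u) - \<mu> * 1 * norm d powr p) (at_right 0)"
    unfolding m_def by (intro tendsto_intros convexity_modulus_quotient_tendsto assms(1))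
  moreover have "((\<lambda>t. (F (g u + t *\<^sub>R d) - F (g u)) / t) \<longlongrightarrow> inner D d) (at_right 0)"
    by (rule GDERIV_directional_quotient_tendsto) fact
  moreover have "\<forall>\<^sub>F t in at_right 0. (F (g u + t *\<^sub>R d) - F (g u)) / t
      \<le> F (g v) - F (g u) - \<mu> * m t * norm d powr p"
    unfolding eventually_at_right_field using quotient_le by (intro exI[of _ 1]) simp
  ultimately have "inner D d \<le> F (g v) - F (g u) - \<mu> * 1 * norm d powr p"
    by (intro tendsto_le[OF trivial_limit_at_right_real])
  then show ?thesis
    by (simp add: d_def)
qed

theorem theorem15:
  fixes g :: "'a::{real_inner, complete_space} \<Rightarrow> 'a"
    and K :: "'a set"
    and F :: "'a \<Rightarrow> real"
    and F' :: "'a \<Rightarrow> 'a"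
    and p \<mu> :: real
  assumes "p > 1"
    and "\<mu> > 0"
    and "general_convex_set g K"
    and "K \<subseteq> range g"
    and "\<And>x. x \<in> K \<Longrightarrow> GDERIV F x :> F' x"
    and "higher_order_strongly_general_convex p \<mu> g K F"
  shows "\<forall>u v. g u \<in> K \<longrightarrow> g v \<in> K \<longrightarrow>
    inner (F' (g u) - F' (g v)) (g u - g v) \<ge> 2 * \<mu> * norm (g v - g u) powr p"
proof (intro allI impI)
  fix u v
  assume uv: "g u \<in> K" "g v \<in> K"
  have "F (g u) + inner (F' (g u)) (g v - g u) + \<mu> * norm (g v - g u) powr p \<le> F (g v)"
    using strongly_general_convex_above_tangent[OF assms(1,6) uv assms(5)[OF uv(1)]] .
  moreover have "F (g v) + inner (F' (g v)) (g u - g v) + \<mu> * norm (g v - g u) powr p \<le> F (g u)"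
    using strongly_general_convex_above_tangent[OF assms(1,6) uv(2,1) assms(5)[OF uv(2)]]
    by (simp add: norm_minus_commute)
  ultimately show "inner (F' (g u) - F' (g v)) (g u - g v) \<ge> 2 * \<mu> * norm (g v - g u) powr p"
    by (simp add: inner_diff_left inner_diff_right)
qed

end
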